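(* Let $n,k,d,r$ be positive integers with $r\ge 2$, $d\ge k$ and $n\ge d+r$. Let $B>0$ be a real number (the file size) and let $\alpha,\beta_1,\beta_2\ge 0$ be real numbers. Suppose that the file size $B$ is supported by the parameters $(n,k,d,r,\alpha,\beta_1,\beta_2)$, i.e. for every information flow graph with these parameters and every data collector $\mathsf{DC}$ in it, the maximum value of an $(\mathsf{S},\mathsf{DC})$-flow is at least $B$. Then the repair-bandwidth per newcomer satisfies $$ d\beta_1+(r-1)\beta_2\ \ge\ \frac{B(2d+r-1)}{k(2d+r-k)} ,$$ and this lower bound can be met (with equality) only when $$(\beta_1,\beta_2)=\Big(\frac{2B}{k(2d+r-k)},\ \frac{B}{k(2d+r-k)}\Big).$$
   Context: Setting (cooperative repair in distributed storage). A file of size $B$ is stored on $n$ nodes, each storing $\alpha$ packets; a data collector must be able to retrieve the file from any $k$ nodes. Whenever $r$ nodes fail, $r$ newcomers replace them: in a first phase each newcomer connects to $d$ surviving nodes and downloads $\beta_1$ packets from each; in a second phase each newcomer sends $\beta_2$ packets to each of the other $r-1$ newcomers. The repair-bandwidth per newcomer is $\gamma=d\beta_1+(r-1)\beta_2$. Information flow graph. Given $(n,k,d,r,\alpha,\beta_1,\beta_2)$, an information flow graph is a directed graph with edge capacities, built in stages as follows. (i) Stage $-1$ has a single vertex $\mathsf{S}$ (the source). (ii) Stage $0$ has $n$ vertices $\mathsf{Out}_1,\dots,\mathsf{Out}_n$, one for each initial storage node, with an edge of capacity $\alpha$ from $\mathsf{S}$ to each of them. (iii) For each stage $t=1,2,\dots,s$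 (any finite number $s\ge 0$ of repairs), an arbitrary set $\mathcal{S}_t\subseteq\{1,\dots,n\}$ of $r$ node indices fails. For each $i\in\mathcal{S}_t$, new vertices $\mathsf{In}_i,\mathsf{Mid}_i,\mathsf{Out}_i$ are added in stage $t$ (the new $\mathsf{Out}_i$ replaces the earlier vertex with the same index as the current "out" vertex of node $i$). For each $i\in\mathcal{S}_t$, an arbitrary choice is made of $d$ distinct surviving nodes (indices not in $\mathcal{S}_t$), and there is an edge of capacity $\beta_1$ from the current "out" vertex of each of these $d$ nodes (lying in an earlier stage) to $\mathsf{In}_i$. For each $i\in\mathcal{S}_t$ there is an edge of infinite capacity from $\mathsf{In}_i$ to $\mathsf{Mid}_i$ and an edge of capacity $\alpha$ from $\mathsf{Mid}_i$ to $\mathsf{Out}_i$. For each ordered pair of distinct $i,j\in\mathcal{S}_t$ there is an edge of capacity $\beta_2$ from $\mathsf{In}_i$ to $\mathsf{Mid}_j$. (iv) A data collector, appearing after $s$ repairs, is a vertex $\mathsf{DC}$ with incoming edges of infinite capacity from the current "out" vertices of an arbitrary choice of $k$ distinct nodes. Flow. An $(\mathsf{S},\mathsf{DC})$-flow is a function $F$ from the edges to the non-negative reals such that $F(e)$ does not exceed the capacity of $e$ for each edge $e$ and, for every vertex other than $\mathsf{S}$ and $\mathsf{DC}$, the total flow in equals the total flow out. Its value is the sum of $F(e)$ over the edges $e$ entering $\mathsf{DC}$.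
   Formalization: The claim that equality holds only at the stated (β1, β2) is proved for k ≥ 2; for k = 1 it is false (e.g. n=3, k=d=1, r=2, B=α=β1=1, β2=0 meets the bound). The lower bound itself is proved for all k ≥ 1. *)

theory Defs
  imports
    "HOL-Library.Extended_Real"
    "Graph_Theory.Digraph"
begin

definition is_flow ::
  "('v, 'e) pre_digraph \<Rightarrow> ('e \<Rightarrow> ereal) \<Rightarrow> 'v \<Rightarrow> 'v \<Rightarrow> ('e \<Rightarrow> real) \<Rightarrow> bool" where
  "is_flow G c x y F \<longleftrightarrow>
     (\<forall>e\<in>arcs G. 0 \<le> F e \<and> ereal (F e) \<le> c e) \<and>
     (\<forall>v\<in>verts G - {x, y}. (\<Sum>e\<in>in_arcs G v. F e) = (\<Sum>e\<in>out_arcs G v. F e))"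

definition flow_value :: "('v, 'e) pre_digraph \<Rightarrow> 'v \<Rightarrow> ('e \<Rightarrow> real) \<Rightarrow> real" where
  "flow_value G y F = (\<Sum>e\<in>in_arcs G y. F e)"

text \<open>
  The supremum is taken in the extended reals so that it is meaningful without side conditions.
  In an information flow graph it is a maximum: the arcs leaving the source have finite
  capacity, so the values are bounded, and the supremum is attained by compactness.
\<close>

definition max_flow_value ::
  "('v, 'e) pre_digraph \<Rightarrow> ('e \<Rightarrow> ereal) \<Rightarrow> 'v \<Rightarrow> 'v \<Rightarrow> ereal" where
  "max_flow_value G c x y = (SUP F\<in>{F. is_flow G c x y F}. ereal (flow_value G y F))"

text \<open>
  The first argument of \<open>In\<close>, \<open>Mid\<close>, \<open>Out\<close> is the stage in which the vertex is created, the
  second one is the index of the storage node.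
\<close>

datatype ifg_vertex = Source | In nat nat | Mid nat nat | Out nat nat | DC

type_synonym ifg_arc = "ifg_vertex \<times> ifg_vertex"

text \<open>
  A history of \<open>s\<close> repairs: \<open>S t\<close> is the set of nodes failing in stage \<open>t\<close>, and \<open>H t i\<close> the set
  of surviving nodes contacted by newcomer \<open>i\<close> in stage \<open>t\<close>. Values of \<open>S\<close> and \<open>H\<close> at other
  arguments are irrelevant.
\<close>

definition repair_history ::
  "nat \<Rightarrow> nat \<Rightarrow> nat \<Rightarrow> nat \<Rightarrow> (nat \<Rightarrow> nat set) \<Rightarrow> (nat \<Rightarrow> nat \<Rightarrow> nat set) \<Rightarrow> bool" where
  "repair_history n d r s S H \<longleftrightarrow>
     (\<forall>t\<in>{1..s}. S t \<subseteq> {1..n} \<and> card (S t) = r \<and>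
        (\<forall>i\<in>S t. H t i \<subseteq> {1..n} - S t \<and> card (H t i) = d))"

text \<open>
  \<open>Out (out_stage S t i) i\<close> is the current out-vertex of node \<open>i\<close> after \<open>t\<close> repairs.
\<close>

primrec out_stage :: "(nat \<Rightarrow> nat set) \<Rightarrow> nat \<Rightarrow> nat \<Rightarrow> nat" where
  "out_stage S 0 i = 0"
| "out_stage S (Suc t) i = (if i \<in> S (Suc t) then Suc t else out_stage S t i)"

definition ifg_arcs ::
  "nat \<Rightarrow> nat \<Rightarrow> (nat \<Rightarrow> nat set) \<Rightarrow> (nat \<Rightarrow> nat \<Rightarrow> nat set) \<Rightarrow> nat set \<Rightarrow> ifg_arc set" where
  "ifg_arcs n s S H K =
     {(Source, Out 0 i) | i. i \<in> {1..n}} \<union>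
     {(Out (out_stage S (t - 1) j) j, In t i) | t i j. t \<in> {1..s} \<and> i \<in> S t \<and> j \<in> H t i} \<union>
     {(In t i, Mid t i) | t i. t \<in> {1..s} \<and> i \<in> S t} \<union>
     {(In t i, Mid t j) | t i j. t \<in> {1..s} \<and> i \<in> S t \<and> j \<in> S t \<and> i \<noteq> j} \<union>
     {(Mid t i, Out t i) | t i. t \<in> {1..s} \<and> i \<in> S t} \<union>
     {(Out (out_stage S s i) i, DC) | i. i \<in> K}"

definition ifg_verts :: "nat \<Rightarrow> nat \<Rightarrow> (nat \<Rightarrow> nat set) \<Rightarrow> ifg_vertex set" where
  "ifg_verts n s S =
     {Source, DC} \<union> {Out 0 i | i. i \<in> {1..n}} \<union>
     (\<Union>t\<in>{1..s}. \<Union>i\<in>S t. {In t i, Mid t i, Out t i})"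

definition info_flow_graph ::
  "nat \<Rightarrow> nat \<Rightarrow> (nat \<Rightarrow> nat set) \<Rightarrow> (nat \<Rightarrow> nat \<Rightarrow> nat set) \<Rightarrow> nat set
     \<Rightarrow> (ifg_vertex, ifg_arc) pre_digraph" where
  "info_flow_graph n s S H K =
     \<lparr>verts = ifg_verts n s S, arcs = ifg_arcs n s S H K, tail = fst, head = snd\<rparr>"

text \<open>Pairs of vertices that never form an arc are given capacity \<open>0\<close>.\<close>

fun ifg_capacity :: "real \<Rightarrow> real \<Rightarrow> real \<Rightarrow> ifg_arc \<Rightarrow> ereal" where
  "ifg_capacity \<alpha> \<beta>1 \<beta>2 (Source, Out t i) = ereal \<alpha>"
| "ifg_capacity \<alpha> \<beta>1 \<beta>2 (Out t j, In u i) = ereal \<beta>1"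
| "ifg_capacity \<alpha> \<beta>1 \<beta>2 (In t i, Mid u j) = (if i = j then \<infinity> else ereal \<beta>2)"
| "ifg_capacity \<alpha> \<beta>1 \<beta>2 (Mid t i, Out u j) = ereal \<alpha>"
| "ifg_capacity \<alpha> \<beta>1 \<beta>2 (Out t i, DC) = \<infinity>"
| "ifg_capacity \<alpha> \<beta>1 \<beta>2 _ = 0"

definition file_size_supported ::
  "nat \<Rightarrow> nat \<Rightarrow> nat \<Rightarrow> nat \<Rightarrow> real \<Rightarrow> real \<Rightarrow> real \<Rightarrow> real \<Rightarrow> bool" where
  "file_size_supported n k d r \<alpha> \<beta>1 \<beta>2 B \<longleftrightarrow>
     (\<forall>s S H K. repair_history n d r s S H \<and> K \<subseteq> {1..n} \<and> card K = k \<longrightarrow>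
        ereal B \<le> max_flow_value (info_flow_graph n s S H K) (ifg_capacity \<alpha> \<beta>1 \<beta>2) Source DC)"

lemma out_stage_cases:
  "out_stage S t i = 0 \<or> out_stage S t i \<in> {1..t} \<and> i \<in> S (out_stage S t i)"
  by (induction t) auto

lemma out_stage_in_verts:
  assumes "i \<in> {1..n}" "t \<le> s"
  shows "Out (out_stage S t i) i \<in> ifg_verts n s S"
  using out_stage_cases[of S t i] assms by (auto simp: ifg_verts_def)

lemma fin_digraph_info_flow_graph:
  assumes hist: "repair_history n d r s S H" and K: "K \<subseteq> {1..n}"
  shows "fin_digraph (info_flow_graph n s S H K)"
proof -
  have S: "S t \<subseteq> {1..n}" if "t \<in> {1..s}" for t
    using hist that by (auto simp: repair_history_def)
  have H: "H t i \<subseteq> {1..n}" if "t \<in> {1..s}" "i \<in> S t" for t i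
    using hist that unfolding repair_history_def by blast
  have ends: "fst e \<in> ifg_verts n s S \<and> snd e \<in> ifg_verts n s S"
    if e: "e \<in> ifg_arcs n s S H K" for e
  proof -
    have 1: "Out (out_stage S (t - 1) j) j \<in> ifg_verts n s S"
      if "t \<in> {1..s}" "i \<in> S t" "j \<in> H t i" for t i j
      using H[OF that(1,2)] that by (intro out_stage_in_verts) auto
    have 2: "Out (out_stage S s i) i \<in> ifg_verts n s S" if "i \<in> K" for i
      using K that by (intro out_stage_in_verts) auto
    have 3: "In t i \<in> ifg_verts n s S" "Mid t i \<in> ifg_verts n s S" "Out t i \<in> ifg_verts n s S"
      if "t \<in> {1..s}" "i \<in> S t" for t i
      using that by (auto simp: ifg_verts_def)
    have 4: "Source \<in> ifg_verts n s S" "DC \<in> ifg_verts n s S"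
      "i \<in> {1..n} \<Longrightarrow> Out 0 i \<in> ifg_verts n s S" for i
      by (auto simp: ifg_verts_def)
    consider i where "e = (Source, Out 0 i)" "i \<in> {1..n}"
      | t i j where "e = (Out (out_stage S (t - 1) j) j, In t i)" "t \<in> {1..s}" "i \<in> S t" "j \<in> H t i"
      | t i where "e = (In t i, Mid t i)" "t \<in> {1..s}" "i \<in> S t"
      | t i j where "e = (In t i, Mid t j)" "t \<in> {1..s}" "i \<in> S t" "j \<in> S t"
      | t i where "e = (Mid t i, Out t i)" "t \<in> {1..s}" "i \<in> S t"
      | i where "e = (Out (out_stage S s i) i, DC)" "i \<in> K"
      using e unfolding ifg_arcs_def by blast
    then show ?thesis
      by cases (use 1 2 3 4 in auto)
  qed
  have "finite (S t)" if "t \<in> {1..s}" for t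
    using S[OF that] finite_subset by blast
  then have finV: "finite (ifg_verts n s S)"
    unfolding ifg_verts_def by (intro finite_UnI finite_UN_I) simp_all
  have "ifg_arcs n s S H K \<subseteq> ifg_verts n s S \<times> ifg_verts n s S"
    using ends by (auto simp: mem_Times_iff)
  then have "finite (ifg_arcs n s S H K)"
    using finV by (meson finite_SigmaI finite_subset)
  then show ?thesis
    using ends finV by unfold_locales (auto simp: info_flow_graph_def)
qed

end

theory Submission
  imports Defs
begin

text \<open>
  Write \<open>\<gamma>\<close> for the repair bandwidth. A history that collects the data from newcomers in
  groups of sizes \<open>\<ell>\<^sub>1, \<ell>\<^sub>2, \<dots>\<close> (summing to \<open>k\<close>) has a cut showing
  \<open>B \<le> k \<gamma> - \<beta>1 k (k - 1) / 2 - (\<beta>2 - \<beta>1 / 2) Q\<close> with \<open>Q = (\<Sum>t. \<ell>\<^sub>t (\<ell>\<^sub>t - 1))\<close>.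
  Groups of size 1 give \<open>Q = 0\<close>, which settles \<open>\<beta>2 \<le> \<beta>1 / 2\<close>; groups of size \<open>r\<close> (the last one
  possibly smaller) make \<open>Q\<close> large enough to settle \<open>\<beta>2 \<ge> \<beta>1 / 2\<close>. For \<open>k \<ge> 2\<close> both bounds are
  strict unless \<open>\<beta>2 = \<beta>1 / 2\<close>.
\<close>

section \<open>Flow values and cuts\<close>

text \<open>Conservation is summed over \<open>W - {y}\<close>, so the flow value is the total
  inflow of vertices of \<open>W\<close> minus their total outflow. Arcs inside \<open>W\<close>
  occur in both totals and cancel; the arcs leaving \<open>W\<close> only lower the value and are
  dropped.\<close>

lemma flow_value_le_cut:
  fixes G :: "('v, 'e) pre_digraph"
  assumes G: "fin_digraph G" and flow: "is_flow G c x y F"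
    and W: "W \<subseteq> verts G" "x \<notin> W" "y \<in> W" and sink: "out_arcs G y = {}"
  shows "flow_value G y F \<le> (\<Sum>e\<in>{e \<in> arcs G. tail G e \<notin> W \<and> head G e \<in> W}. F e)"
proof -
  interpret fin_digraph G by (fact G)
  define I where "I = {e \<in> arcs G. head G e \<in> W}"
  define J where "J = {e \<in> arcs G. tail G e \<in> W}"
  have fin: "finite I" "finite J" "finite W"
    using finite_subset[OF W(1)] by (auto simp: I_def J_def)
  have F0: "F e \<ge> 0" if "e \<in> arcs G" for e
    using flow that by (auto simp: is_flow_def)
  have "(\<Sum>v\<in>W. \<Sum>e\<in>{e \<in> I. head G e = v}. F e) = sum F I"
    by (rule sum.group) (use fin in \<open>auto simp: I_def\<close>)
  moreover have "{e \<in> I. head G e = v} = in_arcs G v" if "v \<in> W" for v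
    using that by (auto simp: I_def)
  ultimately have in_sum: "(\<Sum>v\<in>W. sum F (in_arcs G v)) = sum F I"
    by simp
  have "(\<Sum>v\<in>W. \<Sum>e\<in>{e \<in> J. tail G e = v}. F e) = sum F J"
    by (rule sum.group) (use fin in \<open>auto simp: J_def\<close>)
  moreover have "{e \<in> J. tail G e = v} = out_arcs G v" if "v \<in> W" for v
    using that by (auto simp: J_def)
  ultimately have out_sum: "(\<Sum>v\<in>W. sum F (out_arcs G v)) = sum F J"
    by simp
  have "(\<Sum>v\<in>W - {y}. sum F (in_arcs G v)) = (\<Sum>v\<in>W - {y}. sum F (out_arcs G v))"
    by (rule sum.cong) (use flow W in \<open>auto simp: is_flow_def\<close>)
  then have "flow_value G y F + sum F J = sum F I"
    using in_sum out_sum W(3) fin(3) sink by (simp add: sum.remove flow_value_def)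
  moreover have "sum F I = sum F (I - J) + sum F (I \<inter> J)"
    using fin(1) by (metis add.commute sum.Int_Diff)
  moreover have "sum F (I \<inter> J) \<le> sum F J"
    by (rule sum_mono2) (use fin F0 in \<open>auto simp: J_def\<close>)
  moreover have "I - J = {e \<in> arcs G. tail G e \<notin> W \<and> head G e \<in> W}"
    by (auto simp: I_def J_def)
  ultimately show ?thesis by simp
qed

section \<open>The staged repair history and its cut\<close>

lemma in_block_if_le:
  fixes p :: "nat \<Rightarrow> nat"
  assumes "p 0 = 0" "0 < j" "j \<le> p m"
  shows "\<exists>u\<in>{1..m}. j \<in> {p (u - 1)<..p u}"
  using assms(3)
proof (induction m)
  case 0
  then show ?case using assms by simp
next
  case (Suc m)
  show ?case
  proof (cases "j \<le> p m")
    case True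
    then show ?thesis using Suc.IH by fastforce
  next
    case False
    then have "j \<in> {p (Suc m - 1)<..p (Suc m)}" using Suc.prems by simp
    then show ?thesis by (intro bexI[of _ "Suc m"]) auto
  qed
qed

lemma out_stage_eqI:
  assumes "u \<ge> 1" "u \<le> t" "j \<in> S u" "\<And>v. u < v \<Longrightarrow> v \<le> t \<Longrightarrow> j \<notin> S v"
  shows "out_stage S t j = u"
  using assms(2,4)
proof (induction t)
  case 0
  then show ?case using assms(1) by simp
next
  case (Suc t)
  show ?case
  proof (cases "u = Suc t")
    case True
    then show ?thesis using assms(3) by simp
  next
    case False
    then show ?thesis using Suc by simp
  qed
qed

text \<open>The form fits both families of arcs that enter the cut below. An upper bound on their
  number suffices, since \<beta>1 and \<beta>2 are nonnegative.\<close>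

lemma card_UN_UN_image_le:
  assumes "finite T" "\<And>t. t \<in> T \<Longrightarrow> finite (L t)"
    and "\<And>t i. t \<in> T \<Longrightarrow> i \<in> L t \<Longrightarrow> finite (M t i) \<and> card (M t i) \<le> m t"
  shows "card (\<Union>t\<in>T. \<Union>i\<in>L t. f t i ` M t i) \<le> (\<Sum>t\<in>T. card (L t) * m t)"
proof -
  have "card (\<Union>t\<in>T. \<Union>i\<in>L t. f t i ` M t i) \<le> (\<Sum>t\<in>T. card (\<Union>i\<in>L t. f t i ` M t i))"
    by (rule card_UN_le) fact
  also have "\<dots> \<le> (\<Sum>t\<in>T. card (L t) * m t)"
  proof (rule sum_mono)
    fix t assume t: "t \<in> T"
    have "card (\<Union>i\<in>L t. f t i ` M t i) \<le> (\<Sum>i\<in>L t. card (f t i ` M t i))"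
      by (rule card_UN_le) (use assms t in auto)
    also have "\<dots> \<le> (\<Sum>i\<in>L t. m t)"
      using assms(3)[OF t] card_image_le le_trans by (intro sum_mono) blast
    finally show "card (\<Union>i\<in>L t. f t i ` M t i) \<le> card (L t) * m t" by simp
  qed
  finally show ?thesis .
qed

text \<open>
  In stage \<open>t\<close> the nodes \<open>p (t - 1) + 1, \<dots>, p t\<close> fail for the last time, together with filler
  nodes that the data collector ignores, and each newcomer contacts all of \<open>1, \<dots>, p (t - 1)\<close>.
  The cut separates the final incarnations of the nodes \<open>1, \<dots>, k\<close> from everything else.
\<close>

lemma supported_imp_cut_bound:
  fixes p :: "nat \<Rightarrow> nat"
  assumes kd: "k \<le> d" and n: "d + r \<le> n" and \<beta>: "\<beta>1 \<ge> 0" "\<beta>2 \<ge> 0"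
    and supp: "file_size_supported n k d r \<alpha> \<beta>1 \<beta>2 B"
    and p: "p 0 = 0" "mono p" "p s = k" "\<And>t. p t \<le> k" "\<And>t. p t - p (t - 1) \<le> r"
  shows "B \<le> (\<Sum>t\<in>{1..s}. real (p t - p (t - 1)) *
               (real (d - p (t - 1)) * \<beta>1 + real (r - (p t - p (t - 1))) * \<beta>2))"
proof -
  define L where "L t = {p (t - 1)<..p t}" for t
  \<comment> \<open>Fillers come from the top end of \<open>{1..n}\<close> and bring the number of
    failures up to \<open>r\<close>. As \<open>k + r \<le> n\<close>, they never touch the nodes
    \<open>1, \<dots>, k\<close>.\<close>
  define S where "S t = L t \<union> {n - (r - (p t - p (t - 1)))<..n}" for t
  have kn: "k + r \<le> n" using kd n by simp
  have disj: "L t \<inter> {n - (r - (p t - p (t - 1)))<..n} = {}" for t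
    using p(4)[of t] kn by (auto simp: L_def)
  have card_L: "card (L t) = p t - p (t - 1)" and fin_L: "finite (L t)" for t
    by (auto simp: L_def)
  have S_sub: "S t \<subseteq> {1..n}" for t
    using p(4)[of t] kn by (auto simp: L_def S_def)
  have fin_S: "finite (S t)" for t by (simp add: S_def fin_L)
  have card_S: "card (S t) = r" for t
    using p(5)[of t] kn card_Un_disjoint[OF fin_L _ disj[of t]] by (simp add: S_def card_L)
  have card_SL: "card (S t - L t) = r - (p t - p (t - 1))" for t
    using card_Diff_subset[OF fin_L, of t "S t"] card_S[of t] card_L[of t] by (auto simp: S_def)
  have old: "{1..p (t - 1)} \<subseteq> {1..n} - S t" for t
    using p(4)[of "t - 1"] kn by (auto simp: S_def L_def)
  \<comment> \<open>There is room for \<open>d\<close> contacts because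
    \<open>p (t - 1) \<le> k \<le> d\<close>, and at least \<open>d\<close> nodes survive the stage.
    All newcomers of a stage share one contact set.\<close>
  have "\<exists>H. {1..p (t - 1)} \<subseteq> H \<and> H \<subseteq> {1..n} - S t \<and> card H = d" for t
  proof (rule exists_subset_between)
    show "card {1..p (t - 1)} \<le> d" using p(4)[of "t - 1"] kd by simp
    show "d \<le> card ({1..n} - S t)"
      using card_Diff_subset[OF fin_S S_sub] card_S n by simp
  qed (use old in auto)
  then obtain h where h: "\<And>t. {1..p (t - 1)} \<subseteq> h t" "\<And>t. h t \<subseteq> {1..n} - S t" "\<And>t. card (h t) = d"
    by metis
  define H where "H t i = h t" for t and i :: nat
  have fin_h: "finite (h t)" for t using h(2)[of t] finite_subset by blast
  have hist: "repair_history n d r s S H"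
    using S_sub card_S h by (auto simp: repair_history_def H_def)
  define K where "K = {1..k}"
  have K: "K \<subseteq> {1..n}" "card K = k" using kn by (auto simp: K_def)
  define G where "G = info_flow_graph n s S H K"
  have G: "fin_digraph G" unfolding G_def by (rule fin_digraph_info_flow_graph[OF hist K(1)])
  have arcs_G: "arcs G = ifg_arcs n s S H K" "tail G = fst" "head G = snd"
    by (simp_all add: G_def info_flow_graph_def)
  \<comment> \<open>Later blocks start above \<open>p u\<close> and fillers lie above
    \<open>k\<close>, so the failure of a node in its own block is its last.\<close>
  have not_later: "j \<notin> S v" if "j \<in> L u" "u < v" for j u v
  proof -
    have "p u \<le> p (v - 1)" using p(2) that(2) by (auto intro!: monoD[of p])
    moreover have "j \<le> p u" "j \<le> k" using that(1) p(4)[of u] by (auto simp: L_def)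
    ultimately show ?thesis using kn by (auto simp: S_def L_def)
  qed
  have out_L: "out_stage S t j = u" if "j \<in> L u" "1 \<le> u" "u \<le> t" for t j u
    using that not_later by (intro out_stage_eqI) (auto simp: S_def)
  have current: "\<exists>u\<in>{1..t}. j \<in> L u \<and> out_stage S t j = u" if "0 < j" "j \<le> p t" for j t
    using in_block_if_le[of p j t] p(1) that out_L by (fastforce simp: L_def)
  define W where "W = {DC} \<union> (\<Union>t\<in>{1..s}. \<Union>i\<in>L t. {In t i, Mid t i, Out t i})"
  define X where "X = {e \<in> arcs G. tail G e \<notin> W \<and> head G e \<in> W}"
  \<comment> \<open>\<open>X1\<close> holds the downloads from contacts outside the earlier blocks,
    \<open>X2\<close> the exchanges sent by the fillers of the same stage.\<close>
  define X1 where "X1 = (\<Union>t\<in>{1..s}. \<Union>i\<in>L t.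
    (\<lambda>j. (Out (out_stage S (t - 1) j) j, In t i)) ` (h t - {1..p (t - 1)}))"
  define X2 where "X2 = (\<Union>t\<in>{1..s}. \<Union>i\<in>L t. (\<lambda>j. (In t j, Mid t i)) ` (S t - L t))"
  have fin_X: "finite X1" "finite X2"
    by (auto simp: X1_def X2_def fin_L fin_S fin_h)
  have X_sub: "X \<subseteq> X1 \<union> X2"
  proof
    fix e assume "e \<in> X"
    then have arc: "e \<in> ifg_arcs n s S H K" and out: "fst e \<notin> W" and into: "snd e \<in> W"
      by (auto simp: X_def arcs_G)
    consider i where "e = (Source, Out 0 i)" "i \<in> {1..n}"
      | t i j where "e = (Out (out_stage S (t - 1) j) j, In t i)" "t \<in> {1..s}" "i \<in> S t" "j \<in> h t"
      | t i where "e = (In t i, Mid t i)" "t \<in> {1..s}" "i \<in> S t"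
      | t i j where "e = (In t i, Mid t j)" "t \<in> {1..s}" "i \<in> S t" "j \<in> S t"
      | t i where "e = (Mid t i, Out t i)" "t \<in> {1..s}" "i \<in> S t"
      | i where "e = (Out (out_stage S s i) i, DC)" "i \<in> K"
      using arc unfolding ifg_arcs_def H_def by blast
    then show "e \<in> X1 \<union> X2"
    proof cases
      case (2 t i j)
      have i: "i \<in> L t" using into 2 by (auto simp: W_def)
      have "j \<notin> {1..p (t - 1)}"
      proof
        assume "j \<in> {1..p (t - 1)}"
        then obtain u where "u \<in> {1..t - 1}" "j \<in> L u" "out_stage S (t - 1) j = u"
          using current[of j "t - 1"] by auto
        then have "fst e \<in> W" using 2 by (auto simp: W_def)
        with out show False by simp
      qed
      then show ?thesis using 2 i unfolding X1_def by blast
    next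
      \<comment> \<open>An infinite arc from \<open>In\<close> to \<open>Mid\<close> has both ends
        in \<open>W\<close> or neither. The infinite arcs into \<open>DC\<close> are excluded in
        case 6, as \<open>p s = k\<close> puts all their tails into \<open>W\<close>.\<close>
      case (3 t i)
      then show ?thesis using into out by (auto simp: W_def)
    next
      case (4 t i j)
      then have "j \<in> L t" "i \<notin> L t" using into out by (auto simp: W_def)
      then show ?thesis using 4 unfolding X2_def by blast
    next
      case (6 i)
      then obtain u where "u \<in> {1..s}" "i \<in> L u" "out_stage S s i = u"
        using current[of i s] p(3) by (auto simp: K_def)
      then have "fst e \<in> W" using 6 by (auto simp: W_def)
      with out show ?thesis by simp
    qed (use into out in \<open>auto simp: W_def\<close>)
  qed
  have value_le: "flow_value G DC F \<le> real (card X1) * \<beta>1 + real (card X2) * \<beta>2"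
    if F: "is_flow G (ifg_capacity \<alpha> \<beta>1 \<beta>2) Source DC F" for F
  proof -
    have cap: "ereal (F e) \<le> ifg_capacity \<alpha> \<beta>1 \<beta>2 e" if "e \<in> X" for e
      using F that by (auto simp: is_flow_def X_def)
    have F1: "F e \<le> \<beta>1" if "e \<in> X \<inter> X1" for e
      using cap[of e] that by (auto simp: X1_def)
    \<comment> \<open>The sender is a filler and the receiver is in the block, so their indices
      differ and the capacity is \<beta>2 rather than infinite.\<close>
    have F2: "F e \<le> \<beta>2" if "e \<in> X - X1" for e
    proof -
      have "e \<in> X2" using that X_sub by auto
      then show ?thesis using cap[of e] that by (auto simp: X2_def split: if_splits)
    qed
    have finX: "finite X" using X_sub fin_X finite_subset by blast
    have "flow_value G DC F \<le> sum F X"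
      unfolding X_def
    proof (rule flow_value_le_cut[OF G F])
      show "W \<subseteq> verts G"
        by (auto simp: W_def G_def info_flow_graph_def ifg_verts_def S_def)
      show "out_arcs G DC = {}" by (auto simp: out_arcs_def arcs_G ifg_arcs_def)
    qed (auto simp: W_def)
    also have "sum F X = sum F (X \<inter> X1) + sum F (X - X1)"
      by (rule sum.Int_Diff[OF finX])
    also have "sum F (X \<inter> X1) \<le> real (card (X \<inter> X1)) * \<beta>1"
      using F1 by (rule sum_bounded_above)
    also have "sum F (X - X1) \<le> real (card (X - X1)) * \<beta>2"
      using F2 by (rule sum_bounded_above)
    also have "real (card (X \<inter> X1)) * \<beta>1 \<le> real (card X1) * \<beta>1"
      using \<beta> fin_X by (intro mult_right_mono) (auto intro: card_mono)
    also have "real (card (X - X1)) * \<beta>2 \<le> real (card X2) * \<beta>2"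
      using \<beta> fin_X X_sub by (intro mult_right_mono) (auto intro!: card_mono)
    finally show ?thesis by simp
  qed
  have "ereal B \<le> max_flow_value G (ifg_capacity \<alpha> \<beta>1 \<beta>2) Source DC"
    using supp hist K unfolding file_size_supported_def G_def by blast
  also have "\<dots> \<le> ereal (real (card X1) * \<beta>1 + real (card X2) * \<beta>2)"
    unfolding max_flow_value_def by (rule SUP_least) (use value_le in auto)
  finally have "B \<le> real (card X1) * \<beta>1 + real (card X2) * \<beta>2" by simp
  moreover have "card X1 \<le> (\<Sum>t\<in>{1..s}. card (L t) * (d - p (t - 1)))"
    unfolding X1_def
  proof (rule card_UN_UN_image_le)
    show "finite (h t - {1..p (t - 1)}) \<and> card (h t - {1..p (t - 1)}) \<le> d - p (t - 1)" for t
      using card_Diff_subset[OF _ h(1), of t] h(3)[of t] fin_h by simp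
  qed (auto simp: fin_L)
  then have "real (card X1) * \<beta>1 \<le> real (\<Sum>t\<in>{1..s}. card (L t) * (d - p (t - 1))) * \<beta>1"
    using \<beta> by (intro mult_right_mono of_nat_mono)
  moreover have "card X2 \<le> (\<Sum>t\<in>{1..s}. card (L t) * (r - (p t - p (t - 1))))"
    unfolding X2_def
  proof (rule card_UN_UN_image_le)
    show "finite (S t - L t) \<and> card (S t - L t) \<le> r - (p t - p (t - 1))" for t
      using card_SL fin_S by simp
  qed (auto simp: fin_L)
  then have "real (card X2) * \<beta>2 \<le> real (\<Sum>t\<in>{1..s}. card (L t) * (r - (p t - p (t - 1)))) * \<beta>2"
    using \<beta> by (intro mult_right_mono of_nat_mono)
  ultimately have "B \<le> real (\<Sum>t\<in>{1..s}. card (L t) * (d - p (t - 1))) * \<beta>1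
      + real (\<Sum>t\<in>{1..s}. card (L t) * (r - (p t - p (t - 1)))) * \<beta>2"
    by linarith
  also have "\<dots> = (\<Sum>t\<in>{1..s}. real (p t - p (t - 1)) *
               (real (d - p (t - 1)) * \<beta>1 + real (r - (p t - p (t - 1))) * \<beta>2))"
    by (simp add: card_L sum_distrib_right sum.distrib[symmetric] distrib_left mult.assoc)
  finally show ?thesis .
qed

section \<open>Evaluating the cut value for blocks of equal size\<close>

text \<open>
  The identity \<open>2 \<ell> x + \<ell>\<^sup>2 = (x + \<ell>)\<^sup>2 - x\<^sup>2\<close> makes the part of the cut value with
  \<open>\<beta>2 = \<beta>1 / 2\<close> independent of the block sizes.
\<close>

lemma cut_sum_eq:
  fixes x :: "nat \<Rightarrow> real"
  assumes "x 0 = 0"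
  shows "(\<Sum>t\<in>{1..s}. (x t - x (t - 1)) * ((d - x (t - 1)) * \<beta>1 + (r - (x t - x (t - 1))) * \<beta>2))
    = x s * (d * \<beta>1 + (r - 1) * \<beta>2) - \<beta>1 / 2 * (x s * (x s - 1))
      - (\<beta>2 - \<beta>1 / 2) * (\<Sum>t\<in>{1..s}. (x t - x (t - 1)) * (x t - x (t - 1) - 1))"
proof (induction s)
  case 0
  then show ?case using assms by simp
next
  case (Suc s)
  then show ?case by (simp add: field_simps)
qed

text \<open>This is \<open>Q\<close> for consecutive blocks of size \<open>c\<close>, the last
  nonempty one possibly smaller: the number of ordered pairs of distinct nodes in a common block.
  For \<open>c \<ge> 1\<close>, \<open>k\<close> blocks always suffice; surplus ones are empty and
  contribute 0.\<close>

definition block_pairs :: "nat \<Rightarrow> nat \<Rightarrow> real" where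
  "block_pairs k c = (\<Sum>t\<in>{1..k}. (real (min (t * c) k) - real (min ((t - 1) * c) k)) *
     (real (min (t * c) k) - real (min ((t - 1) * c) k) - 1))"

lemma supported_imp_block_bound:
  assumes kd: "k \<le> d" and n: "d + r \<le> n" and \<beta>: "\<beta>1 \<ge> 0" "\<beta>2 \<ge> 0"
    and supp: "file_size_supported n k d r \<alpha> \<beta>1 \<beta>2 B" and c: "1 \<le> c" "c \<le> r"
  shows "B \<le> real k * (real d * \<beta>1 + (real r - 1) * \<beta>2) - \<beta>1 / 2 * (real k * (real k - 1))
      - (\<beta>2 - \<beta>1 / 2) * block_pairs k c"
proof -
  define p where "p t = min (t * c) k" for t
  have p_step: "p t - p (t - 1) \<le> c" for t
    by (cases t) (auto simp: p_def)
  have p_le: "p (t - 1) \<le> p t" for t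
    by (cases t) (auto simp: p_def)
  have pk: "p k = k" using c by (simp add: p_def)
  have "B \<le> (\<Sum>t\<in>{1..k}. real (p t - p (t - 1)) *
               (real (d - p (t - 1)) * \<beta>1 + real (r - (p t - p (t - 1))) * \<beta>2))"
  proof (rule supported_imp_cut_bound[OF kd n \<beta> supp])
    show "mono p" by (auto simp: p_def mono_def min_le_iff_disj)
    show "p t - p (t - 1) \<le> r" for t using p_step[of t] c by simp
  qed (use pk in \<open>auto simp: p_def\<close>)
  \<comment> \<open>No truncated subtraction is cut off at 0 here, so each becomes a real
    difference, as \<open>cut_sum_eq\<close> expects.\<close>
  also have "\<dots> = (\<Sum>t\<in>{1..k}. (real (p t) - real (p (t - 1))) *
      ((real d - real (p (t - 1))) * \<beta>1 + (real r - (real (p t) - real (p (t - 1)))) * \<beta>2))"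
  proof (rule sum.cong[OF refl])
    fix t
    have "p (t - 1) \<le> d" using kd by (auto simp: p_def)
    moreover have "p t - p (t - 1) \<le> r" using p_step[of t] c by simp
    ultimately show "real (p t - p (t - 1)) *
        (real (d - p (t - 1)) * \<beta>1 + real (r - (p t - p (t - 1))) * \<beta>2)
      = (real (p t) - real (p (t - 1))) *
        ((real d - real (p (t - 1))) * \<beta>1 + (real r - (real (p t) - real (p (t - 1)))) * \<beta>2)"
      using p_le[of t] by (simp add: of_nat_diff)
  qed
  also have "\<dots> = real k * (real d * \<beta>1 + (real r - 1) * \<beta>2) - \<beta>1 / 2 * (real k * (real k - 1))
      - (\<beta>2 - \<beta>1 / 2) * block_pairs k c"
    using cut_sum_eq[where x = "\<lambda>t. real (p t)" and s = k and d = "real d" and r = "real r"] pk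
    by (simp add: p_def block_pairs_def)
  finally show ?thesis .
qed

lemma block_pairs_1: "block_pairs k 1 = 0"
  unfolding block_pairs_def by (rule sum.neutral) (auto simp: min_def of_nat_diff)

text \<open>The first \<open>q\<close> blocks are full; the remaining terms are nonnegative because
  block sizes are integers.\<close>

lemma block_pairs_ge:
  assumes "q * c \<le> k" "1 \<le> c"
  shows "block_pairs k c \<ge> real q * (real c * (real c - 1))"
proof -
  let ?x = "\<lambda>t. real (min (t * c) k)"
  have "real q * (real c * (real c - 1)) = (\<Sum>t\<in>{1..q}. (?x t - ?x (t - 1)) * (?x t - ?x (t - 1) - 1))"
  proof -
    have "(?x t - ?x (t - 1)) * (?x t - ?x (t - 1) - 1) = real c * (real c - 1)" if "t \<in> {1..q}" for t
    proof -
      have "t * c \<le> q * c" using that by (intro mult_le_mono1) simp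
      then have "t * c \<le> k" using assms(1) by (rule le_trans)
      moreover have "(t - 1) * c \<le> t * c" by simp
      ultimately have "min (t * c) k = t * c" "min ((t - 1) * c) k = (t - 1) * c" by linarith+
      then show ?thesis using that by (simp add: of_nat_diff algebra_simps)
    qed
    then show ?thesis by simp
  qed
  also have "\<dots> \<le> block_pairs k c"
    unfolding block_pairs_def
  proof (rule sum_mono2)
    have "q \<le> q * c" using assms(2) by simp
    then have "q \<le> k" using assms(1) by (rule le_trans)
    then show "{1..q} \<subseteq> {1..k}" by simp
    fix t
    have "?x (t - 1) \<le> ?x t" by (simp add: min_le_iff_disj)
    moreover have "y * (y - 1) \<ge> 0" if "y = real a - real b" "y \<ge> 0" for y a b
    proof (cases "a = b")
      case False
      then have "y \<ge> 1" using that by linarith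
      then show ?thesis by simp
    qed (use that in simp)
    ultimately show "0 \<le> (?x t - ?x (t - 1)) * (?x t - ?x (t - 1) - 1)"
      by (metis diff_ge_0_iff_ge)
  qed simp
  finally show ?thesis .
qed

lemma block_pairs_full:
  assumes "k \<le> c" "1 \<le> k"
  shows "block_pairs k c = real k * (real k - 1)"
proof -
  have full: "min (t * c) k = k" if "t \<ge> 1" for t
    using that assms by (cases t) auto
  have "block_pairs k c = (\<Sum>t\<in>{1..k}. if t = 1 then real k * (real k - 1) else 0)"
    unfolding block_pairs_def
  proof (rule sum.cong[OF refl])
    fix t assume t: "t \<in> {1..k}"
    show "(real (min (t * c) k) - real (min ((t - 1) * c) k)) *
     (real (min (t * c) k) - real (min ((t - 1) * c) k) - 1)
     = (if t = 1 then real k * (real k - 1) else 0)"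
    proof (cases "t = 1")
      case True
      then show ?thesis using assms by simp
    next
      case False
      then show ?thesis using full[of t] full[of "t - 1"] t by auto
    qed
  qed
  also have "\<dots> = real k * (real k - 1)" using assms by simp
  finally show ?thesis .
qed

text \<open>Makes the coefficient of \<open>\<beta>2 - \<beta>1 / 2\<close> strictly favourable for
  blocks of size \<open>r\<close>. If \<open>k > r\<close>, the full blocks cover at least half of
  the \<open>k\<close> nodes, so \<open>2 * block_pairs k r \<ge> k * (r - 1)\<close>; strictness
  then comes from \<open>2 * (k - 1) < 2 * d + r - 1\<close>.\<close>

lemma block_pairs_large:
  assumes "2 \<le> k" "k \<le> d" "2 \<le> r"
  shows "block_pairs k r * (2 * real d + real r - 1) > real k * (real k - 1) * (real r - 1)"
proof (cases "k \<le> r")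
  case True
  then show ?thesis using assms by (simp add: block_pairs_full)
next
  case False
  define q where "q = k div r"
  have q: "q * r \<le> k" "k < q * r + r" "1 \<le> q"
    using False assms(3) div_times_less_eq_dividend[of k r] dividend_less_div_times[of r k]
    by (auto simp: q_def Suc_le_eq div_greater_zero_iff algebra_simps)
  then have "r \<le> q * r" by simp
  then have "k \<le> 2 * (q * r)" using q by linarith
  then have "real k \<le> 2 * (real q * real r)"
    by (metis of_nat_le_iff of_nat_mult of_nat_numeral)
  then have "real k * (real r - 1) \<le> 2 * (real q * real r) * (real r - 1)"
    using assms by (intro mult_right_mono) auto
  also have "\<dots> \<le> 2 * block_pairs k r"
    using block_pairs_ge[OF q(1)] assms by (simp add: algebra_simps)
  finally have "real k * (real r - 1) * (real k - 1) \<le> 2 * block_pairs k r * (real k - 1)"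
    using assms by (intro mult_right_mono) auto
  moreover have "block_pairs k r > 0"
  proof -
    have "0 < real q * (real r * (real r - 1))" using q assms by simp
    then show ?thesis using block_pairs_ge[OF q(1)] assms by linarith
  qed
  then have "block_pairs k r * (2 * (real k - 1)) < block_pairs k r * (2 * real d + real r - 1)"
    using assms by (intro mult_strict_left_mono) auto
  ultimately show ?thesis by (simp add: algebra_simps)
qed

text \<open>For \<open>k = 1\<close> the bound reads \<gamma> \<ge> B and the cuts used here carry
  no information on \<open>\<beta>2 - \<beta>1 / 2\<close>; hence uniqueness is stated for
  \<open>k \<ge> 2\<close>.\<close>

theorem theorem1:
  fixes n k d r :: nat and B \<alpha> \<beta>1 \<beta>2 :: real
  assumes "n \<ge> 1" and "k \<ge> 1" and "d \<ge> 1" and "r \<ge> 2" and "d \<ge> k" and "n \<ge> d + r"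
    and "B > 0" and "\<alpha> \<ge> 0" and "\<beta>1 \<ge> 0" and "\<beta>2 \<ge> 0"
    and "file_size_supported n k d r \<alpha> \<beta>1 \<beta>2 B"
  shows "real d * \<beta>1 + (real r - 1) * \<beta>2
           \<ge> B * (2 * real d + real r - 1) / (real k * (2 * real d + real r - real k)) \<and>
         (k \<ge> 2 \<longrightarrow>
          real d * \<beta>1 + (real r - 1) * \<beta>2
            = B * (2 * real d + real r - 1) / (real k * (2 * real d + real r - real k)) \<longrightarrow>
          (\<beta>1, \<beta>2) = (2 * B / (real k * (2 * real d + real r - real k)),
                      B / (real k * (2 * real d + real r - real k))))"
proof -
  define \<gamma> where "\<gamma> = real d * \<beta>1 + (real r - 1) * \<beta>2"
  define D where "D = 2 * real d + real r - 1"
  define N where "N = real k * (2 * real d + real r - real k)"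
  define \<delta> where "\<delta> = \<beta>2 - \<beta>1 / 2"
  have pos: "D > 0" "N > 0" using assms by (auto simp: D_def N_def)
  have \<gamma>: "\<gamma> = D / 2 * \<beta>1 + (real r - 1) * \<delta>"
    by (simp add: \<gamma>_def D_def \<delta>_def field_simps)
  \<comment> \<open>Scaling by \<open>D\<close> and replacing \<open>D / 2 * \<beta>1\<close> by
    \<open>\<gamma> - (real r - 1) * \<delta>\<close> eliminates \<beta>1. The coefficient of
    \<gamma> becomes \<open>N\<close>, since \<open>k * D - k * (k - 1) = N\<close>.\<close>
  have bound: "B * D \<le> \<gamma> * N - \<delta> * (block_pairs k c * D - real k * (real k - 1) * (real r - 1))"
    if "1 \<le> c" "c \<le> r" for c
  proof -
    have "B \<le> real k * \<gamma> - \<beta>1 / 2 * (real k * (real k - 1)) - \<delta> * block_pairs k c"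
      unfolding \<gamma>_def \<delta>_def
      by (rule supported_imp_block_bound) (use assms that in auto)
    then have "B * D \<le> (real k * \<gamma> - \<beta>1 / 2 * (real k * (real k - 1)) - \<delta> * block_pairs k c) * D"
      using pos by (intro mult_right_mono) auto
    also have "\<dots> = real k * \<gamma> * D - (\<gamma> - (real r - 1) * \<delta>) * (real k * (real k - 1))
        - \<delta> * block_pairs k c * D"
      unfolding \<gamma> by (simp add: algebra_simps)
    also have "\<dots> = \<gamma> * N - \<delta> * (block_pairs k c * D - real k * (real k - 1) * (real r - 1))"
      by (simp add: N_def D_def algebra_simps)
    finally show ?thesis .
  qed
  have strict: "B * D < \<gamma> * N" if "k \<ge> 2" "\<delta> \<noteq> 0"
  proof (cases "\<delta> < 0")
    case True
    then have "\<delta> * (real k * (real k - 1) * (real r - 1)) < 0"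
      using that assms by (intro mult_neg_pos) auto
    then show ?thesis using bound[of 1] assms block_pairs_1[of k] by simp
  next
    case False
    then have "\<delta> * (block_pairs k r * D - real k * (real k - 1) * (real r - 1)) > 0"
      using block_pairs_large[of k d r] that assms by (intro mult_pos_pos) (auto simp: D_def)
    then show ?thesis using bound[of r] assms by simp
  qed
  have "B * D \<le> \<gamma> * N"
  proof (cases "k \<ge> 2 \<and> \<delta> \<noteq> 0")
    case True
    then show ?thesis using strict by simp
  next
    case False
    \<comment> \<open>In both cases the correction term of \<open>bound\<close> vanishes for blocks
      of size 1.\<close>
    then have "\<delta> = 0 \<or> k = 1" using assms(2) by linarith
    then show ?thesis using bound[of 1] assms block_pairs_1[of k] by auto
  qed
  then have "\<gamma> \<ge> B * D / N" using pos by (simp add: field_simps)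
  moreover have "(\<beta>1, \<beta>2) = (2 * B / N, B / N)" if "k \<ge> 2" "\<gamma> = B * D / N"
  proof -
    have "\<gamma> * N = B * D" using that(2) pos by simp
    \<comment> \<open>Equality contradicts \<open>strict\<close> unless \<delta> is 0; then \<gamma>
      determines \<beta>1, and with it \<beta>2.\<close>
    then have "\<delta> = 0" using strict[OF that(1)] by fastforce
    then have "D / 2 * \<beta>1 = B * D / N" "\<beta>2 = \<beta>1 / 2"
      using \<gamma> that(2) by (simp_all add: \<delta>_def)
    then have "\<beta>1 = 2 * B / N" using pos by (simp add: field_simps)
    with \<open>\<beta>2 = \<beta>1 / 2\<close> show ?thesis by simp
  qed
  ultimately show ?thesis unfolding \<gamma>_def D_def N_def by blast
qed

end
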